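(* Let $d=2$. Then for all $m\in\mathbb{N}_0$ and all homogeneous polynomials $f_m$ of degree $m$ in the variables $(x_1,x_2)$ with complex coefficients, the following inequality holds: $$\langle x_2^2f_m,f_m\rangle_{L^2(\mathbb{S}^1)}\ \ge\ \frac{\pi^2}{4(m+4)^2}\,\langle f_m,f_m\rangle_{L^2(\mathbb{S}^1)}.$$
   Context: $\mathbb{S}^1=\{\theta\in\mathbb{R}^2:|\theta|=1\}$ is the unit circle with arc length measure $d\theta$, and $\langle f,g\rangle_{L^2(\mathbb{S}^1)}=\int_{\mathbb{S}^1}f(\theta)\overline{g(\theta)}\,d\theta$. $\mathbb{N}_0$ denotes the non-negative integers. *)

theory Defs
  imports "HOL-Analysis.Analysis" "HOL-Library.Complex_Order"
begin

definition circle_point :: "real \<Rightarrow> real ^ 2" where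
  "circle_point t = vector [cos t, sin t]"

text \<open>
  Arc length measure on the unit circle of the Euclidean plane: the image of Lebesgue measure on
  \<open>[0, 2\<pi>)\<close> under the unit-speed parametrisation.
\<close>

definition arc_length_S1 :: "(real ^ 2) measure" where
  "arc_length_S1 =
     distr (restrict_space lborel {0..<2 * pi}) (restrict_space borel (sphere 0 1)) circle_point"

definition inner_L2_S1 :: "(real ^ 2 \<Rightarrow> complex) \<Rightarrow> (real ^ 2 \<Rightarrow> complex) \<Rightarrow> complex" where
  "inner_L2_S1 f g = (LINT \<theta>|arc_length_S1. f \<theta> * cnj (g \<theta>))"

text \<open>
  Since the field of reals is infinite, a bivariate polynomial may be identified with the function
  it induces on the plane.  The zero polynomial counts as homogeneous of every degree.
\<close>

definition homogeneous_polynomial2 :: "nat \<Rightarrow> (real ^ 2 \<Rightarrow> complex) \<Rightarrow> bool" where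
  "homogeneous_polynomial2 m f \<longleftrightarrow>
     (\<exists>c :: nat \<Rightarrow> complex.
        \<forall>x. f x = (\<Sum>k\<le>m. c k * complex_of_real (x $ 1) ^ k * complex_of_real (x $ 2) ^ (m - k)))"

text \<open>
  The \<open>distr\<close> above is not degenerate: the parametrisation is measurable, injective on
  \<open>[0, 2\<pi>)\<close>, of unit speed, and the resulting integral is the expected one.
\<close>

lemma circle_point_nth [simp]: "circle_point t $ 1 = cos t" "circle_point t $ 2 = sin t"
  by (simp_all add: circle_point_def)

lemma norm_circle_point [simp]: "norm (circle_point t) = 1"
  by (simp add: norm_vec_def L2_set_def UNIV_2 flip: power2_eq_square)

lemma circle_point_has_vector_derivative:
  "(circle_point has_vector_derivative vector [- sin t, cos t]) (at t)"
proof -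
  have 1: "circle_point = (\<lambda>t. cos t *\<^sub>R axis 1 1 + sin t *\<^sub>R axis 2 1)"
    by (rule ext) (simp add: vec_eq_iff forall_2 axis_def)
  have 2: "(vector [- sin t, cos t] :: real ^ 2)
      = (- sin t) *\<^sub>R axis 1 1 + cos t *\<^sub>R axis 2 1"
    by (simp add: vec_eq_iff forall_2 axis_def)
  show ?thesis
    unfolding 1 2 has_vector_derivative_def
    by (rule derivative_eq_intros refl | simp add: algebra_simps fun_eq_iff)+
qed

lemma norm_circle_point_derivative: "norm (vector [- sin t, cos t] :: real ^ 2) = 1"
  by (simp add: norm_vec_def L2_set_def UNIV_2 flip: power2_eq_square)

lemma circle_point_bij_betw: "bij_betw circle_point {0..<2 * pi} (sphere 0 1)"
  unfolding bij_betw_def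
proof
  show "inj_on circle_point {0..<2 * pi}"
  proof (rule inj_onI)
    fix s t assume st: "s \<in> {0..<2 * pi}" "t \<in> {0..<2 * pi}" and eq: "circle_point s = circle_point t"
    have sc: "sin s = sin t" "cos s = cos t"
      using arg_cong[OF eq, of "\<lambda>v. v $ 2"] arg_cong[OF eq, of "\<lambda>v. v $ 1"] by simp_all
    have "cos (s - t) = 1"
      unfolding cos_diff sc by (metis add.commute power2_eq_square sin_cos_squared_add)
    then obtain n :: int where n: "s - t = of_int n * 2 * pi"
      using cos_one_2pi_int by blast
    have "\<bar>s - t\<bar> < 2 * pi"
      using st by auto
    hence "\<bar>of_int n :: real\<bar> * (2 * pi) < 1 * (2 * pi)"
      unfolding n by (simp add: abs_mult)
    hence "\<bar>of_int n :: real\<bar> < 1"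
      using mult_less_cancel_right_pos pi_gt_zero by fastforce
    hence "n = 0"
      by linarith
    with n show "s = t"
      by simp
  qed
  show "circle_point ` {0..<2 * pi} = sphere 0 1"
  proof (intro subset_antisym subsetI)
    fix x :: "real ^ 2" assume "x \<in> sphere 0 1"
    hence "(x $ 1)\<^sup>2 + (x $ 2)\<^sup>2 = 1"
      by (simp add: norm_vec_def L2_set_def UNIV_2)
    then obtain t where "0 \<le> t" "t < 2 * pi" "x $ 1 = cos t" "x $ 2 = sin t"
      by (rule sincos_total_2pi)
    thus "x \<in> circle_point ` {0..<2 * pi}"
      by (intro image_eqI[of _ _ t]) (simp_all add: vec_eq_iff forall_2)
  qed auto
qed

lemma circle_point_measurable:
  "circle_point \<in> restrict_space lborel {0..<2 * pi} \<rightarrow>\<^sub>M restrict_space borel (sphere 0 1)"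
proof -
  have "continuous_on UNIV circle_point"
    using circle_point_has_vector_derivative
    by (meson continuous_at_imp_continuous_on has_vector_derivative_continuous)
  hence "circle_point \<in> borel_measurable borel"
    by (rule borel_measurable_continuous_onI)
  hence "circle_point \<in> borel_measurable (restrict_space lborel {0..<2 * pi})"
    by (simp add: measurable_restrict_space1)
  thus ?thesis
    by (auto intro: measurable_restrict_space2)
qed

lemma inner_L2_S1_eq:
  assumes "f \<in> borel_measurable borel" "g \<in> borel_measurable borel"
  shows "inner_L2_S1 f g =
    (LINT t:{0..<2 * pi}|lborel. f (circle_point t) * cnj (g (circle_point t)))"
proof -
  have "(\<lambda>x. cnj (g x)) \<in> borel_measurable borel"
    by (rule measurable_compose[OF assms(2)])
       (intro borel_measurable_continuous_onI continuous_intros)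
  with assms(1) have "(\<lambda>\<theta>. f \<theta> * cnj (g \<theta>)) \<in> borel_measurable (restrict_space borel (sphere 0 1))"
    by (intro measurable_restrict_space1 borel_measurable_times)
  thus ?thesis
    by (simp add: inner_L2_S1_def arc_length_S1_def integral_distr[OF circle_point_measurable]
        integral_restrict_space set_lebesgue_integral_def)
qed

end

(*
  Put z = e^(2it). On the circle f_m(cos t, sin t) = e^(-imt) p(z) with a polynomial p of degree
  at most m, and 4 sin^2 t = |1 - z|^2. By Parseval the two sides become the sum of |p_j|^2 and the
  discrete Dirichlet energy of the coefficients, extended by zero at j = -1 and j = m + 1. The lowest
  eigenvalue of that path Laplacian is 4 sin^2 (pi / (2 (m + 2))), with the positive eigenvector
  sin ((j + 1) pi / (m + 2)), and sin u >= u - u^3 / 6 gives the stated constant.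
*)

theory Submission
  imports Defs "HOL-Computational_Algebra.Polynomial"
begin

text \<open>Expanding the square of \<open>y - t x\<close> gives a weighted Young inequality. It is
  an equality for \<open>y = t x\<close>, so nothing is lost when \<open>t\<close> is the ratio of
  neighbouring eigenvector values.\<close>

lemma norm_diff_square_ge:
  fixes x y :: "'a::real_inner"
  assumes "t > 0"
  shows "(1 - t) * (norm x)\<^sup>2 + (1 - 1 / t) * (norm y)\<^sup>2 \<le> (norm (y - x))\<^sup>2"
proof -
  have "0 \<le> (norm (y - t *\<^sub>R x))\<^sup>2 / t"
    using assms by simp
  also have "\<dots> = (norm y)\<^sup>2 / t + t * (norm x)\<^sup>2 - 2 * (x \<bullet> y)"
    using assms unfolding power2_norm_eq_inner
    by (simp add: inner_diff inner_commute field_simps)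
  finally show ?thesis
    by (simp add: power2_norm_eq_inner inner_diff inner_commute algebra_simps)
qed

text \<open>Ground state substitution: each edge is estimated with the ratio of the values of the positive
  eigenvector at its two ends, and the contributions at each vertex add up to the eigenvalue.\<close>

lemma discrete_dirichlet_inequality:
  fixes a :: "nat \<Rightarrow> 'a::real_inner"
  assumes "a (Suc m) = 0"
  shows "4 * (sin (pi / (2 * (real m + 2))))\<^sup>2 * (\<Sum>j\<le>m. (norm (a j))\<^sup>2)
    \<le> (norm (a 0))\<^sup>2 + (\<Sum>j\<le>m. (norm (a (Suc j) - a j))\<^sup>2)"
proof -
  define \<phi> where "\<phi> = pi / (real m + 2)"
  \<comment> \<open>The index is shifted: \<open>S (Suc j)\<close> belongs to \<open>a j\<close>,
    and the zeros \<open>S 0\<close> and \<open>S (m + 2)\<close> sit at the boundary points j = -1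
    and j = m + 1.\<close>
  define S where "S n = sin (real n * \<phi>)" for n :: nat
  define \<mu> where "\<mu> = 2 - 2 * cos \<phi>"
  have half: "pi / (2 * (real m + 2)) = \<phi> / 2"
    by (simp add: \<phi>_def)
  have mu: "\<mu> = 4 * (sin (pi / (2 * (real m + 2))))\<^sup>2"
    unfolding half \<mu>_def using cos_double_sin[of "\<phi> / 2"] by simp
  have S_pos: "S n > 0" if "0 < n" "n < m + 2" for n
    unfolding S_def
  proof (rule sin_gt_zero)
    show "real n * \<phi> > 0" using that by (simp add: \<phi>_def)
    have "real n / (real m + 2) < 1" using that by (simp add: field_simps)
    from mult_strict_right_mono[OF this pi_gt_zero] show "real n * \<phi> < pi"
      by (simp add: \<phi>_def)
  qed
  have S_end: "S (m + 2) = 0"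
    by (simp add: S_def \<phi>_def add.commute)
  have rec: "S n + S (Suc (Suc n)) = 2 * cos \<phi> * S (Suc n)" for n
    using sin_diff[of "real (Suc n) * \<phi>" \<phi>] sin_add[of "real (Suc n) * \<phi>" \<phi>]
    by (simp add: S_def algebra_simps)
  \<comment> \<open>The two summands are the shares that vertex n receives from its left and its
    right edge.\<close>
  have mu_S: "\<mu> = (1 - S n / S (Suc n)) + (1 - S (Suc (Suc n)) / S (Suc n))" if "n \<le> m" for n
  proof -
    have "S (Suc n) > 0" using that by (intro S_pos) auto
    then have "(S n + S (Suc (Suc n))) / S (Suc n) = 2 * cos \<phi>"
      unfolding rec by simp
    then show ?thesis
      by (simp add: \<mu>_def add_divide_distrib)
  qed
  \<comment> \<open>Vertex n has so far received only the share of its left edge. For n = 0 this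
    share is 1, because \<open>S 0 = 0\<close>, and accounts for the boundary term.\<close>
  have partial: "\<mu> * (\<Sum>j<n. (norm (a j))\<^sup>2) + (1 - S n / S (Suc n)) * (norm (a n))\<^sup>2
      \<le> (norm (a 0))\<^sup>2 + (\<Sum>j<n. (norm (a (Suc j) - a j))\<^sup>2)" if "n \<le> m" for n
    using that
  proof (induction n)
    case 0
    then show ?case by (simp add: S_def)
  next
    case (Suc n)
    have "S (Suc (Suc n)) / S (Suc n) > 0"
      using Suc.prems by (intro divide_pos_pos S_pos) auto
    from norm_diff_square_ge[OF this, of "a n" "a (Suc n)"] Suc
    show ?case
      unfolding mu_S[OF Suc_leD[OF Suc.prems]] by (simp add: algebra_simps)
  qed
  \<comment> \<open>The missing 1 is the share of the last edge, whose energy is exactly that of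
    \<open>a m\<close> because \<open>a (Suc m) = 0\<close>.\<close>
  have "1 - S m / S (Suc m) = \<mu> - 1"
    using mu_S[of m] S_end by simp
  with partial[of m] have "\<mu> * (\<Sum>j<m. (norm (a j))\<^sup>2) + (\<mu> - 1) * (norm (a m))\<^sup>2
      \<le> (norm (a 0))\<^sup>2 + (\<Sum>j<m. (norm (a (Suc j) - a j))\<^sup>2)"
    by simp
  then show ?thesis
    using assms unfolding mu[symmetric] by (simp add: lessThan_Suc_atMost[symmetric] algebra_simps)
qed

lemma poly_eq_sum_atMost:
  fixes p :: "'a::comm_semiring_1 poly"
  assumes "degree p \<le> n"
  shows "poly p x = (\<Sum>i\<le>n. coeff p i * x ^ i)"
  by (subst poly_as_sum_of_monoms'[OF assms, symmetric]) (simp add: poly_sum poly_monom)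

lemma has_integral_cis_int:
  "((\<lambda>t. cis (2 * of_int k * t)) has_integral (if k = 0 then of_real (2 * pi) else 0)) {0..2 * pi}"
proof (cases "k = 0")
  case True
  then show ?thesis
    using has_integral_const_real[of "1::complex" 0 "2 * pi"] by (simp add: scaleR_conv_of_real)
next
  case False
  define F where "F t = cis (2 * of_int k * t) / (2 * \<i> * of_int k)" for t
  have "(F has_vector_derivative cis (2 * of_int k * t)) (at t within {0..2 * pi})" for t
    unfolding F_def cis_conv_exp using False
    by (auto intro!: derivative_eq_intros has_vector_derivative_real_field simp: field_simps)
  then have "((\<lambda>t. cis (2 * of_int k * t)) has_integral (F (2 * pi) - F 0)) {0..2 * pi}"
    by (intro fundamental_theorem_of_calculus) auto
  moreover have "cis (2 * of_int k * (2 * pi)) = 1"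
    using cis_multiple_2pi[of "2 * of_int k"] by (simp add: mult_ac)
  ultimately show ?thesis
    using False by (simp add: F_def)
qed

text \<open>The squared modulus is a double sum of characters, of which only the diagonal terms
  survive integration. Allowing \<open>n\<close> above the degree avoids computing exact
  degrees.\<close>

lemma parseval_poly:
  assumes "degree p \<le> n"
  shows "((\<lambda>t. of_real ((cmod (poly p (cis (2 * t))))\<^sup>2)) has_integral
    complex_of_real (2 * pi * (\<Sum>i\<le>n. (cmod (coeff p i))\<^sup>2))) {0..2 * pi}"
proof -
  let ?c = "coeff p"
  \<comment> \<open>The frequencies are integers because subtraction on the naturals would
    truncate.\<close>
  have "((\<lambda>t. \<Sum>i\<le>n. \<Sum>j\<le>n. ?c i * cnj (?c j) * cis (2 * of_int (int i - int j) * t)) has_integral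
      (\<Sum>i\<le>n. \<Sum>j\<le>n. ?c i * cnj (?c j) * (if int i - int j = 0 then of_real (2 * pi) else 0))) {0..2 * pi}"
    by (intro has_integral_sum has_integral_mult_right has_integral_cis_int finite_atMost)
  moreover have "(\<Sum>i\<le>n. \<Sum>j\<le>n. ?c i * cnj (?c j) * cis (2 * of_int (int i - int j) * t))
      = of_real ((cmod (poly p (cis (2 * t))))\<^sup>2)" for t
  proof -
    have "cis (2 * of_int (int i - int j) * t) = cis (2 * t) ^ i * cnj (cis (2 * t) ^ j)" for i j
      unfolding Complex.DeMoivre by (simp add: cis_cnj cis_mult algebra_simps)
    then have "(\<Sum>i\<le>n. \<Sum>j\<le>n. ?c i * cnj (?c j) * cis (2 * of_int (int i - int j) * t))
        = poly p (cis (2 * t)) * cnj (poly p (cis (2 * t)))"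
      unfolding poly_eq_sum_atMost[OF assms] cnj_sum sum_product
      by (simp add: mult_ac)
    then show ?thesis
      by (simp only: complex_norm_square)
  qed
  moreover have "(\<Sum>i\<le>n. \<Sum>j\<le>n. ?c i * cnj (?c j) * (if int i - int j = 0 then of_real (2 * pi) else 0))
      = complex_of_real (2 * pi * (\<Sum>i\<le>n. (cmod (?c i))\<^sup>2))"
    by (simp add: if_distrib sum_distrib_left complex_norm_square mult_ac del: of_real_power cong: if_cong)
  ultimately show ?thesis
    by simp
qed

text \<open>This bridges the half-open parameter interval of the circle and the closed interval of
  the gauge integral; the endpoint \<open>b\<close> is negligible.\<close>

lemma set_lebesgue_integral_Ico_eq:
  fixes g :: "real \<Rightarrow> complex"
  assumes "continuous_on {a..b} g" and "(g has_integral I) {a..b}"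
  shows "(LINT t:{a..<b}|lborel. g t) = I"
proof -
  have "set_integrable lborel {a..<b} g"
    by (rule set_integrable_subset[OF borel_integrable_atLeastAtMost'[OF assms(1)]]) auto
  then have "(LINT t:{a..<b}|lborel. g t) = integral {a..<b} g"
    by (rule set_borel_integral_eq_integral)
  also have "\<dots> = integral {a..b} g"
    by (rule integral_spike_set; rule negligible_subset[of "{b}"]) auto
  finally show ?thesis
    using assms(2) by (simp add: integral_unique)
qed

lemma homogeneous_polynomial2_on_circle:
  assumes "homogeneous_polynomial2 m f"
  obtains p where "degree p \<le> m"
    and "\<And>t. f (circle_point t) = cis (- (real m * t)) * poly p (cis (2 * t))"
proof -
  obtain c where c: "\<And>x. f x
      = (\<Sum>k\<le>m. c k * complex_of_real (x $ 1) ^ k * complex_of_real (x $ 2) ^ (m - k))"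
    using assms unfolding homogeneous_polynomial2_def by blast
  \<comment> \<open>Euler's formulas with z = e^(2it): cos t = e^(-it) (1 + z) / 2 and sin t =
    e^(-it) i (1 - z) / 2. By homogeneity every monomial carries the same phase e^(-imt).\<close>
  define q r :: "complex poly" where "q = [:1 / 2, 1 / 2:]" and "r = [:\<i> / 2, - \<i> / 2:]"
  define p where "p = (\<Sum>k\<le>m. smult (c k) (q ^ k * r ^ (m - k)))"
  have deg: "degree q \<le> 1" "degree r \<le> 1"
    by (simp_all add: q_def r_def)
  have "degree (q ^ k * r ^ (m - k)) \<le> m" if "k \<le> m" for k
  proof -
    have "degree (q ^ k) \<le> k" "degree (r ^ (m - k)) \<le> m - k"
      using degree_power_le[of q k] degree_power_le[of r "m - k"]
        mult_le_mono1[OF deg(1), of k] mult_le_mono1[OF deg(2), of "m - k"] by linarith+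
    then show ?thesis
      using degree_mult_le[of "q ^ k" "r ^ (m - k)"] that by linarith
  qed
  then have "degree p \<le> m"
    unfolding p_def by (intro degree_sum_le) (auto intro: order_trans[OF degree_smult_le])
  moreover have "f (circle_point t) = cis (- (real m * t)) * poly p (cis (2 * t))" for t
  proof -
    have sq: "cis (2 * t) = cis t * cis t"
      by (simp add: cis_mult)
    have inv: "cis (- t) * cis t = 1"
      by (simp add: cis_mult)
    have C: "complex_of_real (cos t) = cis (- t) * poly q (cis (2 * t))"
      using inv unfolding q_def sq
      by (simp add: algebra_simps) (simp add: complex_eq_iff flip: mult.assoc)
    have S: "complex_of_real (sin t) = cis (- t) * poly r (cis (2 * t))"
      using inv unfolding r_def sq
      by (simp add: algebra_simps) (simp add: complex_eq_iff flip: mult.assoc)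
    have "complex_of_real (cos t) ^ k * complex_of_real (sin t) ^ (m - k)
        = cis (- (real m * t)) * (poly q (cis (2 * t)) ^ k * poly r (cis (2 * t)) ^ (m - k))"
      if "k \<le> m" for k
    proof -
      have "cis (- t) ^ k * cis (- t) ^ (m - k) = cis (- (real m * t))"
        unfolding power_add[symmetric] using that by (simp add: Complex.DeMoivre)
      then show ?thesis
        by (simp add: C S power_mult_distrib mult_ac)
    qed
    then show ?thesis
      by (simp add: c p_def poly_sum sum_distrib_left mult_ac)
  qed
  ultimately show thesis
    using that by blast
qed

lemma homogeneous_polynomial2_borel_measurable:
  assumes "homogeneous_polynomial2 m f"
  shows "f \<in> borel_measurable borel"
proof -
  obtain c where "f = (\<lambda>x. \<Sum>k\<le>m. c k * complex_of_real (x $ 1) ^ k * complex_of_real (x $ 2) ^ (m - k))"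
    using assms unfolding homogeneous_polynomial2_def by blast
  then show ?thesis
    by (auto intro!: borel_measurable_continuous_onI continuous_intros)
qed

lemma sin_eigenvalue_ge:
  assumes "x \<ge> 0"
  shows "pi / (2 * (x + 4)) \<le> sin (pi / (2 * (x + 2)))"
proof -
  define u where "u = pi / (2 * (x + 2))"
  have u: "0 < u" "u \<le> 1"
    using assms pi_less_4 by (auto simp: u_def field_simps)
  have "\<bar>sin u - u\<bar> \<le> u ^ 3 / 6"
    using Maclaurin_sin_bound[of u 3] u(1)
    by (simp add: sin_coeff_def eval_nat_numeral field_simps)
  then have "u - u ^ 3 / 6 \<le> sin u"
    by linarith
  moreover have "pi / (2 * (x + 4)) \<le> u - u ^ 3 / 6"
  proof -
    \<comment> \<open>Eliminating \<open>x\<close> leaves pi u / (pi + 4 u) to compare with the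
      cubic Taylor bound.\<close>
    have x: "x + 2 = pi / (2 * u)" 
      using assms by (simp add: u_def field_simps)
    then have "x + 4 = (pi + 4 * u) / (2 * u)"
      using u by (simp add: field_simps)
    then have eq: "pi / (2 * (x + 4)) = pi * u / (pi + 4 * u)"
      using u mult_divide_mult_cancel_left[of 2 "pi * u" "pi + 4 * u"] by (simp add: algebra_simps)
    have "u * pi \<le> 1 * 4"
      using u pi_less_4 by (intro mult_mono) auto
    moreover have "u * u \<le> 1 * 1"
      using u by (intro mult_mono) auto
    \<comment> \<open>This is the comparison after clearing the denominator and cancelling
      \<open>pi * u\<close>; each subtracted term is at most 2/3.\<close>
    ultimately have "0 \<le> u\<^sup>2 * (4 - u * pi / 6 - 4 * (u * u) / 6)"
      by (intro mult_nonneg_nonneg zero_le_power2) linarith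
    then show ?thesis
      unfolding eq using u pi_gt_zero
      by (simp add: pos_divide_le_eq add_pos_pos) (simp add: algebra_simps power2_eq_square power3_eq_cube)
  qed
  ultimately show ?thesis
    by (simp add: u_def)
qed

theorem theorem3:
  fixes m :: nat and f :: "real ^ 2 \<Rightarrow> complex"
  assumes "homogeneous_polynomial2 m f"
  shows "inner_L2_S1 (\<lambda>x. complex_of_real ((x $ 2)\<^sup>2) * f x) f
           \<ge> complex_of_real (pi\<^sup>2 / (4 * (real m + 4)\<^sup>2)) * inner_L2_S1 f f"
proof -
  obtain p where deg: "degree p \<le> m"
    and f: "\<And>t. f (circle_point t) = cis (- (real m * t)) * poly p (cis (2 * t))"
    using homogeneous_polynomial2_on_circle[OF assms] by blast
  \<comment> \<open>This is (1 - z) p(z). Its coefficients are the successive differences of those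
    of \<open>p\<close>, so \<open>B\<close> is their Dirichlet energy.\<close>
  define q where "q = p - pCons 0 p"
  define A where "A = (\<Sum>j\<le>m. (cmod (coeff p j))\<^sup>2)"
  define B where "B = (\<Sum>j\<le>Suc m. (cmod (coeff q j))\<^sup>2)"
  have deg_q: "degree q \<le> Suc m"
    unfolding q_def using deg degree_pCons_le[of 0 p]
    by (intro degree_diff_le) auto
  have meas: "f \<in> borel_measurable borel"
    using assms by (rule homogeneous_polynomial2_borel_measurable)
  have ff: "f (circle_point t) * cnj (f (circle_point t)) = of_real ((cmod (poly p (cis (2 * t))))\<^sup>2)" for t
    unfolding complex_norm_square[symmetric] by (simp add: f norm_mult)
  have sin_sq: "complex_of_real ((sin t)\<^sup>2) * of_real ((cmod (poly p (cis (2 * t))))\<^sup>2)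
      = 1 / 4 * of_real ((cmod (poly q (cis (2 * t))))\<^sup>2)" for t
  proof -
    have "4 * (sin t)\<^sup>2 = (cmod (1 - cis (2 * t)))\<^sup>2"
      using sin_cos_squared_add[of "2 * t"] cos_double_sin[of t]
      by (simp add: cmod_power2 power2_diff)
    moreover have "poly q (cis (2 * t)) = (1 - cis (2 * t)) * poly p (cis (2 * t))"
      by (simp add: q_def algebra_simps)
    ultimately have "4 * (sin t)\<^sup>2 * (cmod (poly p (cis (2 * t))))\<^sup>2 = (cmod (poly q (cis (2 * t))))\<^sup>2"
      by (simp add: norm_mult power_mult_distrib)
    from arg_cong[OF this, of complex_of_real] show ?thesis
      by (simp add: mult_ac)
  qed
  have "inner_L2_S1 f f = of_real (2 * pi * A)"
    unfolding inner_L2_S1_eq[OF meas meas] ff A_def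
    by (intro set_lebesgue_integral_Ico_eq parseval_poly deg continuous_intros)
  moreover have "inner_L2_S1 (\<lambda>x. complex_of_real ((x $ 2)\<^sup>2) * f x) f = 1 / 4 * of_real (2 * pi * B)"
  proof -
    have "(\<lambda>x. complex_of_real ((x $ 2)\<^sup>2) * f x) \<in> borel_measurable borel"
      by (intro borel_measurable_times meas borel_measurable_continuous_onI continuous_intros)
    moreover have "complex_of_real ((circle_point t $ 2)\<^sup>2) * f (circle_point t) * cnj (f (circle_point t))
        = 1 / 4 * of_real ((cmod (poly q (cis (2 * t))))\<^sup>2)" for t
      unfolding mult.assoc ff circle_point_nth sin_sq ..
    ultimately show ?thesis
      unfolding B_def
      by (simp only: inner_L2_S1_eq meas)
        (intro set_lebesgue_integral_Ico_eq has_integral_mult_right parseval_poly deg_q continuous_intros)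
  qed
  moreover have "pi\<^sup>2 / (4 * (real m + 4)\<^sup>2) * (2 * pi * A) \<le> 1 / 4 * (2 * pi * B)"
  proof -
    \<comment> \<open>The constant coefficient of \<open>q\<close> is the left boundary edge; the
      summand j = m is the right one, since \<open>coeff p (Suc m) = 0\<close>.\<close>
    have "B = (cmod (coeff p 0))\<^sup>2 + (\<Sum>j\<le>m. (cmod (coeff p (Suc j) - coeff p j))\<^sup>2)"
      unfolding B_def by (subst sum.atMost_Suc_shift) (simp add: q_def)
    then have "4 * (sin (pi / (2 * (real m + 2))))\<^sup>2 * A \<le> B"
      using discrete_dirichlet_inequality[of "coeff p" m] deg
      by (simp add: A_def coeff_eq_0)
    moreover have "(pi / (2 * (real m + 4)))\<^sup>2 * A \<le> (sin (pi / (2 * (real m + 2))))\<^sup>2 * A"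
      by (intro mult_right_mono power_mono sin_eigenvalue_ge) (auto simp: A_def intro: sum_nonneg)
    ultimately have "(pi / (2 * (real m + 4)))\<^sup>2 * A \<le> 1 / 4 * B"
      by linarith
    moreover have "(pi / (2 * (real m + 4)))\<^sup>2 = pi\<^sup>2 / (4 * (real m + 4)\<^sup>2)"
      by (simp only: power_divide power_mult_distrib) simp
    ultimately have "pi\<^sup>2 / (4 * (real m + 4)\<^sup>2) * A \<le> 1 / 4 * B"
      by (simp only:)
    then have "2 * pi * (pi\<^sup>2 / (4 * (real m + 4)\<^sup>2) * A) \<le> 2 * pi * (1 / 4 * B)"
      by (intro mult_left_mono) auto
    then show ?thesis
      by (simp add: mult_ac)
  qed
  moreover have "1 / 4 * complex_of_real (2 * pi * B) = of_real (1 / 4 * (2 * pi * B))"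
    by simp
  \<comment> \<open>The order on complex numbers also demands equal imaginary parts; both sides are
    real, so only the real inequality remains.\<close>
  ultimately show ?thesis
    by (simp only: less_eq_complex_def of_real_mult[symmetric] Re_complex_of_real Im_complex_of_real simp_thms)
qed

end
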